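(* Let $\alpha=m/n$ with $m,n$ relatively prime odd positive integers, let $\sigma\ge 0$ be an integer, let $\zeta_0$ be an integer, and let $\{r(\zeta)\}_{\zeta=\zeta_0}^{\infty}$, $\{q(\zeta)\}_{\zeta=\zeta_0}^{\infty}$ be real sequences such that $r(\zeta)>0$ for all $\zeta\ge\zeta_0$, $q(\zeta)\ge 0$ for all $\zeta\ge\zeta_0$, $q(\zeta)\neq 0$ for infinitely many $\zeta$, and $$\theta(\zeta):=\sum_{s=\zeta}^{\infty}\frac{1}{r^{1/\alpha}(s)}<\infty,\qquad \zeta\ge\zeta_0 .$$ Suppose that one of the following two conditions holds: (i) for some integer $\zeta_1\ge\zeta_0+\sigma$, $$\sum_{\zeta=\zeta_0}^{\infty}\left(\frac{1}{r(\zeta)}\sum_{s=\zeta_1}^{\zeta-1}q(s)\,\theta^{\alpha}(s-\sigma)\right)^{1/\alpha}=\infty;$$ (ii) $$\sum_{s=\zeta_0}^{\infty}q(s)\,\theta^{\alpha+1}(s+1)=\infty .$$ Then the equation $$\Delta\big(r(\zeta)(\Delta x(\zeta))^{\alpha}\big)+q(\zeta)\,x^{\alpha}(\zeta-\sigma)=0,\qquad \zeta\ge\zeta_0,$$ oscillates.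
   Context: The variable $\zeta$ ranges over integers, and $\Delta x(\zeta)=x(\zeta+1)-x(\zeta)$ is the forward difference operator. For a sequence $f$, $f^{p}(\zeta)$ means $(f(\zeta))^{p}$. Since $\alpha$ is a quotient of odd positive integers, $t\mapsto t^{\alpha}$ and $t\mapsto t^{1/\alpha}$ are the real odd power functions on all of $\mathbb{R}$. Empty sums (including sums whose upper limit is less than the lower limit) are $0$. A solution of the equation is a non-trivial real sequence $\{x(\zeta)\}$ defined for $\zeta\ge\zeta_0-\sigma$ that satisfies the equation for all $\zeta\ge\zeta_0$. A solution oscillates if it is neither eventually positive nor eventually negative; the equation oscillates if all its solutions oscillate. *)

theory Defs
  imports "HOL-Analysis.Analysis"
begin

text \<open>
  Sequences indexed by the integers from some point on are represented by total functions on
  \<^typ>\<open>int\<close>; their values below the starting index are never constrained or used.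
\<close>

text \<open>
  \<open>rat_pow m n t\<close> is \<open>t\<close> raised to the exponent \<open>m / n\<close>. For odd \<open>n\<close> the library's
  \<^const>\<open>root\<close> is the real odd \<open>n\<close>-th root on all of the reals (unlike \<open>powr\<close>), so for odd
  \<open>m\<close> and \<open>n\<close> this is the real odd power function. With \<open>\<alpha> = m / n\<close>, the exponents
  \<open>\<alpha>\<close>, \<open>1 / \<alpha>\<close> and \<open>\<alpha> + 1\<close> are \<open>rat_pow m n\<close>, \<open>rat_pow n m\<close> and \<open>rat_pow (m + n) n\<close>.
\<close>

definition rat_pow :: "nat \<Rightarrow> nat \<Rightarrow> real \<Rightarrow> real" where
  "rat_pow m n t = root n t ^ m"

definition fdiff :: "(int \<Rightarrow> real) \<Rightarrow> int \<Rightarrow> real" where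
  "fdiff x \<zeta> = x (\<zeta> + 1) - x \<zeta>"

text \<open>
  The summands below are positive where \<open>r\<close> is, so unconditional summation is the usual sum of
  the series; \<^const>\<open>infsum\<close> is meaningful only under a \<open>summable_on\<close> hypothesis.
\<close>

definition theta :: "nat \<Rightarrow> nat \<Rightarrow> (int \<Rightarrow> real) \<Rightarrow> int \<Rightarrow> real" where
  "theta m n r \<zeta> = (\<Sum>\<^sub>\<infinity>s\<in>{\<zeta>..}. 1 / rat_pow n m (r s))"

definition is_solution ::
  "nat \<Rightarrow> nat \<Rightarrow> int \<Rightarrow> int \<Rightarrow> (int \<Rightarrow> real) \<Rightarrow> (int \<Rightarrow> real) \<Rightarrow> (int \<Rightarrow> real) \<Rightarrow> bool" where
  "is_solution m n \<sigma> \<zeta>0 r q x \<longleftrightarrow>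
     (\<exists>\<zeta>\<ge>\<zeta>0 - \<sigma>. x \<zeta> \<noteq> 0) \<and>
     (\<forall>\<zeta>\<ge>\<zeta>0. fdiff (\<lambda>s. r s * rat_pow m n (fdiff x s)) \<zeta> + q \<zeta> * rat_pow m n (x (\<zeta> - \<sigma>)) = 0)"

definition oscillates :: "(int \<Rightarrow> real) \<Rightarrow> bool" where
  "oscillates x \<longleftrightarrow>
     \<not> (\<forall>\<^sub>F \<zeta> in at_top. x \<zeta> > 0) \<and> \<not> (\<forall>\<^sub>F \<zeta> in at_top. x \<zeta> < 0)"

definition equation_oscillates ::
  "nat \<Rightarrow> nat \<Rightarrow> int \<Rightarrow> int \<Rightarrow> (int \<Rightarrow> real) \<Rightarrow> (int \<Rightarrow> real) \<Rightarrow> bool" where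
  "equation_oscillates m n \<sigma> \<zeta>0 r q \<longleftrightarrow>
     (\<forall>x. is_solution m n \<sigma> \<zeta>0 r q x \<longrightarrow> oscillates x)"

definition series_infinite :: "int \<Rightarrow> (int \<Rightarrow> real) \<Rightarrow> bool" where
  "series_infinite a f \<longleftrightarrow> filterlim (\<lambda>N. \<Sum>s=a..N. f s) at_top at_top"

end

theory Submission imports Defs begin

text \<open>
  Write \<open>\<alpha> = m / n\<close> and \<open>\<rho> = 1 / r\<^bsup>1/\<alpha>\<^esup>\<close>, so that \<open>\<theta>\<close> is the tail sum of \<open>\<rho>\<close>. The equation
  is odd in \<open>x\<close>, so it suffices to refute an eventually positive solution \<open>x\<close>. Its quasi-difference
  \<open>y = r (\<Delta>x)\<^sup>\<alpha>\<close> is then eventually nonincreasing, hence eventually of one sign.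

  If \<open>y \<ge> 0\<close> persists, then \<open>x\<close> is nondecreasing and so bounded below by a positive constant; since
  \<open>q(s) x\<^sup>\<alpha>(s - \<sigma>)\<close> is the decrement of a nonnegative sequence, \<open>q\<close> has bounded partial sums.
  As \<open>\<theta>\<close> is bounded, the inner sum in (i) is bounded and the outer series is dominated by a
  multiple of the convergent series of \<open>\<rho>\<close>; the series in (ii) is dominated by that of \<open>q\<close>.

  If \<open>y\<close> becomes negative, put \<open>u = - y\<close> and \<open>v = u\<^bsup>1/\<alpha>\<^esup>\<close>. Both are nondecreasing, and
  \<open>\<Delta>x = - v \<rho>\<close>. Summing this to infinity gives the key bound \<open>v \<theta> \<le> x\<close>
  (lemma \<open>flux_theta_le\<close>). Under (i), inserting \<open>x \<ge> v \<theta> \<ge> const \<theta>\<close> in the equation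
  bounds \<open>u\<close> from below by a multiple of the inner sum, whence the terms of (i) are at most a
  multiple of \<open>- \<Delta>x\<close>, which has bounded sums because \<open>x > 0\<close>. Under (ii), the sequence
  \<open>D = x - \<theta> v\<close> is nonnegative and satisfies \<open>- \<Delta>D(s) = \<theta>(s + 1) \<Delta>v(s)\<close>; the equation and
  the key bound give \<open>q(s) \<theta>\<^sup>\<alpha>(s + 1) \<le> \<Delta>u(s) / u(s + 1)\<close>, and a Bernoulli inequality
  bounds this relative increment of \<open>u = v\<^sup>\<alpha>\<close> by a multiple of that of \<open>v\<close>. So the terms of (ii)
  are at most a multiple of \<open>- \<Delta>D\<close>, and the series is again bounded. In all four
  cases divergence is refuted by comparing the terms with the increments of a sequence that is
  bounded above (lemma \<open>not_series_infinite_if_le_increments\<close>).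
\<close>

section \<open>The odd power functions\<close>

lemma rat_pow_uminus: "odd m \<Longrightarrow> rat_pow m n (- t) = - rat_pow m n t"
  by (simp add: rat_pow_def real_root_minus power_minus_odd)

lemma rat_pow_mult: "rat_pow m n (s * t) = rat_pow m n s * rat_pow m n t"
  by (simp add: rat_pow_def real_root_mult power_mult_distrib)

lemma rat_pow_divide: "rat_pow m n (s / t) = rat_pow m n s / rat_pow m n t"
  by (simp add: rat_pow_def real_root_divide power_divide)

lemma rat_pow_zero: "odd m \<Longrightarrow> rat_pow m n 0 = 0"
  using odd_pos by (simp add: rat_pow_def)

lemma rat_pow_one: "odd n \<Longrightarrow> rat_pow m n 1 = 1"
  using odd_pos by (simp add: rat_pow_def)

lemma rat_pow_inverse: "odd m \<Longrightarrow> odd n \<Longrightarrow> rat_pow n m (rat_pow m n t) = t"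
  by (simp add: rat_pow_def odd_real_root_power_cancel odd_real_root_pow)

lemma rat_pow_mono: "odd m \<Longrightarrow> odd n \<Longrightarrow> s \<le> t \<Longrightarrow> rat_pow m n s \<le> rat_pow m n t"
  unfolding rat_pow_def by (intro power_mono_odd) (auto simp: odd_pos)

lemma rat_pow_pos: "odd n \<Longrightarrow> t > 0 \<Longrightarrow> rat_pow m n t > 0"
  unfolding rat_pow_def by (simp add: odd_pos)

lemma rat_pow_nonneg: "odd n \<Longrightarrow> t \<ge> 0 \<Longrightarrow> rat_pow m n t \<ge> 0"
  unfolding rat_pow_def by (simp add: odd_pos)

lemma rat_pow_add_denominator: "odd n \<Longrightarrow> rat_pow (m + n) n t = rat_pow m n t * t"
  by (simp add: rat_pow_def power_add odd_real_root_pow)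

text \<open>
  The case \<open>\<alpha> = m\<close> is Bernoulli's inequality; for \<open>\<alpha> = m / n\<close> apply that case to
  \<open>t\<^bsup>1/n\<^esup>\<close>, which is at least \<open>t\<close> on the unit interval.
\<close>

lemma one_minus_rat_pow_le:
  assumes "odd n" and "0 \<le> t" and "t \<le> 1"
  shows "1 - rat_pow m n t \<le> real m * (1 - t)"
proof -
  define \<tau> where "\<tau> = root n t"
  have n: "0 < n" using assms(1) by (rule odd_pos)
  have \<tau>: "0 \<le> \<tau>" "\<tau> \<le> 1" "\<tau> ^ n = t"
    using n assms by (auto simp: \<tau>_def)
  have "t \<le> \<tau>" using power_decreasing[of 1 n \<tau>] n \<tau> by simp
  then have "real m * (1 - \<tau>) \<le> real m * (1 - t)"
    by (intro mult_left_mono) auto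
  moreover have "1 + real m * (\<tau> - 1) \<le> (1 + (\<tau> - 1)) ^ m"
    by (rule Bernoulli_inequality) (use \<tau> in simp)
  then have "1 - \<tau> ^ m \<le> real m * (1 - \<tau>)" by (simp add: algebra_simps)
  ultimately show ?thesis by (simp add: rat_pow_def \<tau>_def)
qed

section \<open>Sums over integer intervals\<close>

lemma sum_atLeastAtMost_int_step:
  fixes f :: "int \<Rightarrow> real"
  assumes "a \<le> N"
  shows "sum f {a..N} = sum f {a..N - 1} + f N"
proof -
  have "{a..N} = insert N {a..N - 1}" using assms by auto
  then show ?thesis by simp
qed

lemma sum_le_increments:
  fixes f g :: "int \<Rightarrow> real"
  assumes "\<And>s. s \<ge> Z \<Longrightarrow> f s \<le> g (s + 1) - g s" and "a \<le> Z" and "Z \<le> N"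
  shows "sum f {a..N - 1} \<le> sum f {a..Z - 1} + (g N - g Z)"
  using assms(3)
proof (induction N rule: int_ge_induct)
  case (step N)
  then show ?case
    using assms(1)[of N] assms(2) sum_atLeastAtMost_int_step[of a N f] by simp
qed simp

lemma sums_bounded_if_le_increments:
  fixes f g :: "int \<Rightarrow> real"
  assumes "\<And>s. s \<ge> Z \<Longrightarrow> f s \<le> g (s + 1) - g s" and "\<And>s. s \<ge> Z \<Longrightarrow> g s \<le> B" and "a \<le> Z"
  obtains C where "\<And>N. N \<ge> Z \<Longrightarrow> sum f {a..N - 1} \<le> C"
proof
  fix N assume "N \<ge> Z"
  then show "sum f {a..N - 1} \<le> sum f {a..Z - 1} + (B - g Z)"
    using sum_le_increments[of Z f g a N] assms by force
qed

lemma not_series_infinite_if_le_increments: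
  fixes f g :: "int \<Rightarrow> real"
  assumes "\<And>s. s \<ge> Z \<Longrightarrow> f s \<le> g (s + 1) - g s" and "\<And>s. s \<ge> Z \<Longrightarrow> g s \<le> B" and "a \<le> Z"
  shows "\<not> series_infinite a f"
proof
  assume "series_infinite a f"
  obtain C where C: "\<And>N. N \<ge> Z \<Longrightarrow> sum f {a..N - 1} \<le> C"
    using sums_bounded_if_le_increments[of Z f g B a] assms by blast
  have "\<forall>\<^sub>F N in at_top. C < sum f {a..N}"
    using \<open>series_infinite a f\<close> unfolding series_infinite_def filterlim_at_top_dense by blast
  then obtain M where M: "\<And>N. N \<ge> M \<Longrightarrow> C < sum f {a..N}"
    by (auto simp: eventually_at_top_linorder)
  have "Z \<le> max M Z + 1" by linarith
  from C[OF this] show False using M[of "max M Z"] by simp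
qed

section \<open>Eventually positive solutions\<close>

locale positive_solution =
  fixes m n :: nat and \<sigma> \<zeta>0 Z :: int and r q x :: "int \<Rightarrow> real"
  assumes odd_m: "odd m" and odd_n: "odd n"
    and delay_nonneg: "\<sigma> \<ge> 0"
    and r_pos: "\<And>s. s \<ge> \<zeta>0 \<Longrightarrow> r s > 0"
    and q_nonneg: "\<And>s. s \<ge> \<zeta>0 \<Longrightarrow> q s \<ge> 0"
    and summable: "\<And>s. s \<ge> \<zeta>0 \<Longrightarrow> (\<lambda>s. 1 / rat_pow n m (r s)) summable_on {s..}"
    and start: "Z \<ge> \<zeta>0 + \<sigma>"
    and x_pos: "\<And>s. s \<ge> Z - \<sigma> \<Longrightarrow> x s > 0"
    and equation: "\<And>s. s \<ge> Z \<Longrightarrow>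
      fdiff (\<lambda>s. r s * rat_pow m n (fdiff x s)) s + q s * rat_pow m n (x (s - \<sigma>)) = 0"
begin

abbreviation "P \<equiv> rat_pow m n"
abbreviation "R \<equiv> rat_pow n m"
abbreviation "\<theta> \<equiv> theta m n r"

definition "\<rho> s = 1 / R (r s)"

text \<open>
  The sequences \<open>u = - y\<close> and \<open>v = u\<^bsup>1/\<alpha>\<^esup>\<close>, signed so that both are positive along a
  decreasing solution.
\<close>

definition "u s = - (r s * P (fdiff x s))"
definition "v s = R (u s)"

lemmas P_mono = rat_pow_mono[OF odd_m odd_n]
  and R_mono = rat_pow_mono[OF odd_n odd_m]
  and P_pos = rat_pow_pos[OF odd_n, of _ m]
  and R_pos = rat_pow_pos[OF odd_m, of _ n]
  and P_nonneg = rat_pow_nonneg[OF odd_n, of _ m]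
  and R_nonneg = rat_pow_nonneg[OF odd_m, of _ n]
  and R_P = rat_pow_inverse[OF odd_m odd_n]
  and P_R = rat_pow_inverse[OF odd_n odd_m]

lemma start_ge: "Z \<ge> \<zeta>0"
  using start delay_nonneg by simp

lemma \<rho>_pos: "s \<ge> \<zeta>0 \<Longrightarrow> \<rho> s > 0"
  unfolding \<rho>_def using R_pos r_pos by simp

lemma theta_nonneg: "s \<ge> \<zeta>0 \<Longrightarrow> \<theta> s \<ge> 0"
  unfolding theta_def by (intro infsum_nonneg) (simp add: R_nonneg r_pos less_imp_le)

lemma theta_step: 
  assumes "s \<ge> \<zeta>0"
  shows "\<theta> s = \<rho> s + \<theta> (s + 1)"
proof -
  have "{s..} = insert s {s + 1..}" by auto
  then show ?thesis
    using infsum_insert[of "\<lambda>s. 1 / R (r s)" "{s + 1..}" s] summable[of "s + 1"] assms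
    by (simp add: theta_def \<rho>_def)
qed

lemma theta_le_initial: "s \<ge> \<zeta>0 \<Longrightarrow> \<theta> s \<le> \<theta> \<zeta>0"
proof (induction s rule: int_ge_induct)
  case (step s)
  then show ?case using theta_step[of s] \<rho>_pos[of s] by simp
qed simp

lemma u_step: "s \<ge> Z \<Longrightarrow> u (s + 1) - u s = q s * P (x (s - \<sigma>))"
  using equation[of s] by (simp add: u_def fdiff_def)

lemma u_mono:
  assumes "Z \<le> s" and "s \<le> t"
  shows "u s \<le> u t"
  using assms(2)
proof (induction t rule: int_ge_induct)
  case (step t)
  have "q t * P (x (t - \<sigma>)) \<ge> 0"
    using step assms start_ge x_pos[of "t - \<sigma>"] by (simp add: q_nonneg P_nonneg)
  then show ?case using step u_step[of t] assms by simp
qed simp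

lemma x_step:
  assumes "s \<ge> \<zeta>0"
  shows "x (s + 1) = x s - v s * \<rho> s"
proof -
  have "u s = r s * P (- fdiff x s)"
    by (simp add: u_def rat_pow_uminus odd_m)
  then have "v s = R (r s) * (- fdiff x s)"
    by (simp add: v_def rat_pow_mult R_P)
  then have "v s * \<rho> s = - fdiff x s"
    using R_pos[of "r s"] r_pos[OF assms] by (simp add: \<rho>_def)
  then show ?thesis by (simp add: fdiff_def)
qed

lemma inner_sum_nonneg:
  assumes "\<zeta>1 \<ge> \<zeta>0 + \<sigma>"
  shows "(\<Sum>s=\<zeta>1..N. q s * P (\<theta> (s - \<sigma>))) \<ge> 0"
  using assms delay_nonneg by (intro sum_nonneg mult_nonneg_nonneg q_nonneg P_nonneg theta_nonneg) auto

subsection \<open>Nondecreasing solutions\<close>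

text \<open>
  Here \<open>- u = y\<close> stays nonnegative while decreasing by \<open>q(s) x\<^sup>\<alpha>(s - \<sigma>)\<close>, and \<open>x\<close> is bounded
  below by its value at \<open>Z\<close>; the increments of the bounded sequence \<open>u / x\<^sup>\<alpha>(Z)\<close> therefore dominate
  \<open>q\<close>.
\<close>

lemma q_le_increments:
  assumes u_nonpos: "\<And>s. s \<ge> Z \<Longrightarrow> u s \<le> 0" and s: "s \<ge> Z + \<sigma>"
  shows "q s \<le> u (s + 1) / P (x Z) - u s / P (x Z)"
proof -
  have x_mono: "x Z \<le> x t" if "Z \<le> t" for t
    using that
  proof (induction t rule: int_ge_induct)
    case (step t)
    have "v t \<le> 0"
      using R_mono[OF u_nonpos[OF step(1)]] by (simp add: v_def rat_pow_zero odd_n)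
    then have "v t * \<rho> t \<le> 0"
      using \<rho>_pos[of t] start_ge step(1) by (intro mult_nonpos_nonneg) auto
    then show ?case using x_step[of t] start_ge step by simp
  qed simp
  have "q s * P (x Z) \<le> q s * P (x (s - \<sigma>))"
    using s start_ge delay_nonneg by (intro mult_left_mono P_mono x_mono q_nonneg) auto
  also have "\<dots> = u (s + 1) - u s" using u_step[of s] s delay_nonneg by simp
  finally show ?thesis
    using P_pos[OF x_pos[of Z]] delay_nonneg by (simp add: field_simps)
qed

lemma nondecreasing_imp_not_series_1:
  assumes u_nonpos: "\<And>s. s \<ge> Z \<Longrightarrow> u s \<le> 0" and \<zeta>1: "\<zeta>1 \<ge> \<zeta>0 + \<sigma>"
  shows "\<not> series_infinite \<zeta>0 (\<lambda>\<zeta>. R (1 / r \<zeta> * (\<Sum>s=\<zeta>1..\<zeta> - 1. q s * P (\<theta> (s - \<sigma>)))))"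
    (is "\<not> series_infinite _ ?f")
proof -
  define Z' where "Z' = max \<zeta>1 (Z + \<sigma>)"
  have Z': "Z' \<ge> \<zeta>1" "Z' \<ge> Z + \<sigma>" "Z' \<ge> \<zeta>0" "Z' \<ge> Z"
    using start_ge delay_nonneg by (auto simp: Z'_def)
  define c where "c = P (\<theta> \<zeta>0) / P (x Z)"
  have c: "c \<ge> 0"
    unfolding c_def using x_pos[of Z] delay_nonneg
    by (intro divide_nonneg_nonneg P_nonneg theta_nonneg) auto
  have incr: "q s * P (\<theta> (s - \<sigma>)) \<le> c * u (s + 1) - c * u s" if "s \<ge> Z'" for s
  proof -
    have "q s * P (\<theta> (s - \<sigma>)) \<le> q s * P (\<theta> \<zeta>0)"
      using that Z' start by (intro mult_left_mono P_mono theta_le_initial q_nonneg) auto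
    also have "\<dots> \<le> (u (s + 1) / P (x Z) - u s / P (x Z)) * P (\<theta> \<zeta>0)"
      using that Z' by (intro mult_right_mono q_le_increments P_nonneg theta_nonneg u_nonpos) auto
    finally show ?thesis by (simp add: c_def algebra_simps)
  qed
  have bdd: "c * u s \<le> 0" if "s \<ge> Z'" for s
    using that Z' c u_nonpos[of s] by (intro mult_nonneg_nonpos) auto
  obtain C where C: "\<And>N. N \<ge> Z' \<Longrightarrow> (\<Sum>s=\<zeta>1..N - 1. q s * P (\<theta> (s - \<sigma>))) \<le> C"
    using sums_bounded_if_le_increments[where f = "\<lambda>s. q s * P (\<theta> (s - \<sigma>))" and g = "\<lambda>s. c * u s",
        OF incr bdd Z'(1)] by blast
  have "?f s \<le> (- R C * \<theta> (s + 1)) - (- R C * \<theta> s)" if "s \<ge> Z'" for s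
  proof -
    have "?f s = \<rho> s * R (\<Sum>s=\<zeta>1..s - 1. q s * P (\<theta> (s - \<sigma>)))"
      by (simp add: rat_pow_mult rat_pow_divide rat_pow_one odd_m \<rho>_def)
    also have "\<dots> \<le> \<rho> s * R C"
      using \<rho>_pos[of s] that Z' C by (intro mult_left_mono R_mono) auto
    also have "\<rho> s = \<theta> s - \<theta> (s + 1)" using theta_step[of s] that Z' by simp
    finally show ?thesis by (simp add: algebra_simps)
  qed
  moreover have "C \<ge> 0" using C[of Z'] inner_sum_nonneg[OF \<zeta>1, of "Z' - 1"] by simp
  then have "- R C * \<theta> s \<le> 0" if "s \<ge> Z'" for s
    using that Z' by (simp add: R_nonneg theta_nonneg)
  ultimately show ?thesis
    by (rule not_series_infinite_if_le_increments) (use Z' in auto)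
qed

lemma nondecreasing_imp_not_series_2:
  assumes u_nonpos: "\<And>s. s \<ge> Z \<Longrightarrow> u s \<le> 0"
  shows "\<not> series_infinite \<zeta>0 (\<lambda>s. q s * rat_pow (m + n) n (\<theta> (s + 1)))"
proof -
  define b where "b = P (\<theta> \<zeta>0) * \<theta> \<zeta>0"
  have b: "b \<ge> 0" by (simp add: b_def P_nonneg theta_nonneg)
  define g where "g s = u s / P (x Z) * b" for s
  have "q s * rat_pow (m + n) n (\<theta> (s + 1)) \<le> g (s + 1) - g s" if s: "s \<ge> Z + \<sigma>" for s
  proof -
    have s0: "s \<ge> \<zeta>0" using s start_ge delay_nonneg by simp
    have "rat_pow (m + n) n (\<theta> (s + 1)) \<le> b"
      unfolding b_def rat_pow_add_denominator[OF odd_n]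
      using s0 by (intro mult_mono P_mono theta_le_initial P_nonneg theta_nonneg) auto
    then have "q s * rat_pow (m + n) n (\<theta> (s + 1)) \<le> q s * b"
      using q_nonneg[OF s0] by (rule mult_left_mono)
    also have "\<dots> \<le> (u (s + 1) / P (x Z) - u s / P (x Z)) * b"
      using s b by (intro mult_right_mono q_le_increments u_nonpos) auto
    finally show ?thesis by (simp add: g_def algebra_simps)
  qed
  moreover have "g s \<le> 0" if "s \<ge> Z + \<sigma>" for s
    unfolding g_def using that delay_nonneg b u_nonpos[of s] P_pos[OF x_pos[of Z]]
    by (intro mult_nonpos_nonneg divide_nonpos_pos) auto
  ultimately show ?thesis
    by (rule not_series_infinite_if_le_increments[where Z = "Z + \<sigma>"])
      (use start_ge delay_nonneg in auto)
qed

end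

subsection \<open>Decreasing solutions\<close>

locale decreasing_positive_solution = positive_solution +
  assumes u_start_pos: "u Z > 0"
begin

lemma u_pos: "s \<ge> Z \<Longrightarrow> u s > 0"
  using u_mono[of Z s] u_start_pos by simp

lemma v_pos: "s \<ge> Z \<Longrightarrow> v s > 0"
  unfolding v_def using u_pos R_pos by simp

lemma v_mono: "Z \<le> s \<Longrightarrow> s \<le> t \<Longrightarrow> v s \<le> v t"
  unfolding v_def by (intro R_mono u_mono)

lemma x_antimono:
  assumes "Z \<le> s" and "s \<le> t"
  shows "x t \<le> x s"
  using assms(2)
proof (induction t rule: int_ge_induct)
  case (step t)
  have "v t * \<rho> t \<ge> 0" 
    using v_pos[of t] \<rho>_pos[of t] start_ge step(1) assms by (intro mult_nonneg_nonneg) auto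
  then show ?case using x_step[of t] start_ge step assms by simp
qed simp

text \<open>
  Past \<open>s\<close> the solution loses at least \<open>v(s) \<rho>(t)\<close> at each step \<open>t\<close>, because \<open>v\<close> is
  nondecreasing; as it stays positive, it must have had at least \<open>v(s) \<theta>(s)\<close> to lose.
\<close>

lemma flux_theta_le:
  assumes s: "s \<ge> Z"
  shows "v s * \<theta> s \<le> x s"
proof -
  have sums: "v s * sum \<rho> {s..N - 1} \<le> x s" if "N \<ge> s" for N
  proof -
    have "v s * \<rho> t \<le> - x (t + 1) - (- x t)" if "t \<ge> s" for t
    proof -
      have "v s * \<rho> t \<le> v t * \<rho> t"
        using that s start_ge \<rho>_pos[of t] by (intro mult_right_mono v_mono) auto
      then show ?thesis using x_step[of t] that s start_ge by simp
    qed
    then have "(\<Sum>t=s..N - 1. v s * \<rho> t) \<le> (\<Sum>t=s..s - 1. v s * \<rho> t) + (- x N - (- x s))"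
      by (rule sum_le_increments) (use that in auto)
    then show ?thesis 
      using x_pos[of N] that s delay_nonneg by (simp add: sum_distrib_left)
  qed
  have "\<theta> s \<le> x s / v s"
    unfolding theta_def
  proof (rule infsum_le_finite_sums)
    show "(\<lambda>s. 1 / R (r s)) summable_on {s..}" using summable s start_ge by simp
  next
    fix F assume F: "finite F" "F \<subseteq> {s..}"
    define N where "N = Max (insert s F) + 1"
    have N: "F \<subseteq> {s..N - 1}" "N \<ge> s"
      using F by (auto simp: N_def intro: Max_ge add_increasing2)
    have "sum \<rho> F \<le> sum \<rho> {s..N - 1}"
      using N s start_ge \<rho>_pos by (intro sum_mono2) (auto intro!: less_imp_le)
    also have "\<dots> \<le> x s / v s"
      using sums[OF N(2)] v_pos[OF s] by (simp add: field_simps)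
    finally show "(\<Sum>s\<in>F. 1 / R (r s)) \<le> x s / v s" by (simp add: \<rho>_def)
  qed
  then show ?thesis using v_pos[OF s] by (simp add: field_simps)
qed

lemma u_P_theta_le:
  assumes s: "s \<ge> Z"
  shows "u s * P (\<theta> s) \<le> P (x s)"
proof -
  have "u s * P (\<theta> s) = P (v s * \<theta> s)" by (simp add: rat_pow_mult v_def P_R)
  also have "\<dots> \<le> P (x s)" by (intro P_mono flux_theta_le s)
  finally show ?thesis .
qed

lemma decreasing_imp_not_series_1:
  assumes \<zeta>1: "\<zeta>1 \<ge> \<zeta>0 + \<sigma>"
  shows "\<not> series_infinite \<zeta>0 (\<lambda>\<zeta>. R (1 / r \<zeta> * (\<Sum>s=\<zeta>1..\<zeta> - 1. q s * P (\<theta> (s - \<sigma>)))))"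
    (is "\<not> series_infinite _ ?f")
proof -
  define S where "S N = (\<Sum>s=\<zeta>1..N - 1. q s * P (\<theta> (s - \<sigma>)))" for N
  define Z' where "Z' = max \<zeta>1 (Z + \<sigma>)"
  have Z': "Z' \<ge> \<zeta>1" "Z' \<ge> Z + \<sigma>" "Z' \<ge> \<zeta>0" "Z' \<ge> Z"
    using start_ge delay_nonneg by (auto simp: Z'_def)
  have S: "S N \<ge> 0" for N unfolding S_def by (rule inner_sum_nonneg[OF \<zeta>1])
  \<comment> \<open>The first constant serves the increments past \<open>Z'\<close>; the second absorbs the part of the
    inner sum that precedes \<open>Z'\<close>, about which the solution gives no information.\<close>
  define k where "k = min (u Z) (u Z' / (1 + S Z'))"
  have k: "k > 0" "k \<le> u Z"
    using u_pos[of Z] u_pos[of Z'] Z' S[of Z'] by (auto simp: k_def)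
  have u_ge: "k * S N \<le> u N" if "N \<ge> Z'" for N
    using that
  proof (induction N rule: int_ge_induct)
    case base
    have "k * S Z' \<le> u Z' / (1 + S Z') * (1 + S Z')"
      using S[of Z'] k u_pos[of Z'] Z' by (intro mult_mono) (auto simp: k_def)
    then show ?case using S[of Z'] by simp
  next
    case (step N)
    have N: "N - \<sigma> \<ge> Z" "N \<ge> \<zeta>0" "N \<ge> Z" "N - \<sigma> \<ge> \<zeta>0" using step(1) Z' start_ge by auto
    have "k * P (\<theta> (N - \<sigma>)) \<le> u (N - \<sigma>) * P (\<theta> (N - \<sigma>))"
      using N k u_mono[of Z "N - \<sigma>"] by (intro mult_right_mono P_nonneg theta_nonneg) auto
    also have "\<dots> \<le> P (x (N - \<sigma>))" by (rule u_P_theta_le[OF N(1)])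
    finally have "q N * (k * P (\<theta> (N - \<sigma>))) \<le> u (N + 1) - u N"
      unfolding u_step[OF N(3)] using q_nonneg[OF N(2)] by (rule mult_left_mono)
    moreover have "S (N + 1) = S N + q N * P (\<theta> (N - \<sigma>))"
      unfolding S_def using sum_atLeastAtMost_int_step[of \<zeta>1 N] step(1) Z' by simp
    ultimately show ?case using step by (simp add: algebra_simps)
  qed
  have "?f s \<le> (- x (s + 1) / R k) - (- x s / R k)" if s: "s \<ge> Z'" for s
  proof -
    have "R k * ?f s = \<rho> s * R (k * S s)"
      by (simp add: rat_pow_mult rat_pow_divide rat_pow_one odd_m \<rho>_def S_def)
    also have "\<dots> \<le> \<rho> s * v s"
      unfolding v_def using \<rho>_pos[of s] s Z' u_ge by (intro mult_left_mono R_mono) auto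
    also have "\<dots> = - x (s + 1) + x s" using x_step[of s] s Z' by simp
    finally show ?thesis using R_pos[OF k(1)] by (simp add: field_simps)
  qed
  moreover have "- x s / R k \<le> 0" if "s \<ge> Z'" for s
    using x_pos[of s] R_pos[OF k(1)] that Z' delay_nonneg by simp
  ultimately show ?thesis
    by (rule not_series_infinite_if_le_increments) (use Z' in auto)
qed

text \<open>
  As \<open>x\<close> is decreasing, the retarded value \<open>x(s - \<sigma>)\<close> may be replaced by the smaller \<open>x(s + 1)\<close>,
  to which the key bound applies at the point where condition (ii) evaluates \<open>\<theta>\<close>. Dividing by
  \<open>u(s + 1)\<close>, rather than by \<open>u(s)\<close>, produces a ratio in the unit interval, where the Bernoulli
  inequality holds for every exponent.
\<close>

lemma q_P_theta_le:
  assumes s: "s \<ge> Z + \<sigma>"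
  shows "q s * P (\<theta> (s + 1)) \<le> real m / v Z * (v (s + 1) - v s)"
proof -
  have sZ: "s \<ge> Z" "s \<ge> \<zeta>0" using s delay_nonneg start_ge by auto
  have u1: "u (s + 1) > 0" and v0: "v s > 0" and v1: "v (s + 1) > 0" and v01: "v s \<le> v (s + 1)"
    using u_pos v_pos v_mono sZ by auto
  have "u (s + 1) * P (\<theta> (s + 1)) \<le> P (x (s - \<sigma>))"
    using u_P_theta_le[of "s + 1"] P_mono[OF x_antimono[of "s - \<sigma>" "s + 1"]] s sZ delay_nonneg
    by simp
  then have "q s * (u (s + 1) * P (\<theta> (s + 1))) \<le> u (s + 1) - u s"
    unfolding u_step[OF sZ(1)] using q_nonneg[OF sZ(2)] by (rule mult_left_mono)
  then have "q s * P (\<theta> (s + 1)) \<le> 1 - u s / u (s + 1)"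
    using u1 by (simp add: field_simps)
  also have "u s / u (s + 1) = P (v s / v (s + 1))"
    by (simp add: rat_pow_divide v_def P_R)
  also have "1 - P (v s / v (s + 1)) \<le> real m * (1 - v s / v (s + 1))"
    using v0 v1 v01 by (intro one_minus_rat_pow_le odd_n) auto
  also have "\<dots> = real m * (v (s + 1) - v s) / v (s + 1)"
    using v1 by (simp add: field_simps)
  also have "\<dots> \<le> real m * (v (s + 1) - v s) / v Z"
    using v01 v_pos[of Z] v_mono[of Z "s + 1"] sZ by (intro divide_left_mono) auto
  finally show ?thesis by simp
qed

lemma decreasing_imp_not_series_2:
  "\<not> series_infinite \<zeta>0 (\<lambda>s. q s * rat_pow (m + n) n (\<theta> (s + 1)))"
proof -
  define c where "c = real m / v Z"
  have c: "c \<ge> 0" using v_pos[of Z] by (simp add: c_def)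
  define g where "g s = c * (\<theta> s * v s - x s)" for s
  have "q s * rat_pow (m + n) n (\<theta> (s + 1)) \<le> g (s + 1) - g s" if s: "s \<ge> Z + \<sigma>" for s
  proof -
    have s0: "s \<ge> \<zeta>0" using s start_ge delay_nonneg by simp
    have "q s * rat_pow (m + n) n (\<theta> (s + 1)) = q s * P (\<theta> (s + 1)) * \<theta> (s + 1)"
      by (simp add: rat_pow_add_denominator odd_n)
    also have "\<dots> \<le> c * (v (s + 1) - v s) * \<theta> (s + 1)"
      unfolding c_def using s s0 by (intro mult_right_mono q_P_theta_le theta_nonneg) auto
    \<comment> \<open>Summation by parts: the term \<open>- v \<Delta>\<theta> = v \<rho>\<close> left over from the product rule for
      \<open>\<theta> v\<close> is exactly \<open>- \<Delta>x\<close>.\<close>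
    also have "\<dots> = g (s + 1) - g s"
      unfolding g_def x_step[OF s0] theta_step[OF s0] by (simp add: algebra_simps)
    finally show ?thesis .
  qed
  moreover have "g s \<le> 0" if "s \<ge> Z + \<sigma>" for s
    unfolding g_def using c flux_theta_le[of s] that delay_nonneg
    by (intro mult_nonneg_nonpos) (auto simp: mult.commute)
  ultimately show ?thesis
    by (rule not_series_infinite_if_le_increments[where Z = "Z + \<sigma>"])
      (use start_ge delay_nonneg in auto)
qed

end

section \<open>Oscillation\<close>

context positive_solution
begin

text \<open>
  Since \<open>u\<close> is nondecreasing, either it is never positive or it is positive from some point on, and
  in the latter case that point can serve as the new start of the solution.
\<close>

lemma nondecreasing_or_decreasing:
  obtains "\<And>s. s \<ge> Z \<Longrightarrow> u s \<le> 0"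
  | Z' where "decreasing_positive_solution m n \<sigma> \<zeta>0 Z' r q x"
proof (cases "\<exists>Z'\<ge>Z. u Z' > 0")
  case True
  then obtain Z' where Z': "Z' \<ge> Z" "u Z' > 0" by blast
  interpret later: positive_solution m n \<sigma> \<zeta>0 Z' r q x
    using Z' start
    by unfold_locales
      (auto simp: odd_m odd_n delay_nonneg r_pos q_nonneg summable x_pos equation)
  have "decreasing_positive_solution m n \<sigma> \<zeta>0 Z' r q x"
    by unfold_locales (rule Z'(2))
  then show thesis by (rule that(2))
next
  case False
  then show thesis by (intro that(1)) (force simp: not_less)
qed

lemma not_series_1:
  assumes "\<zeta>1 \<ge> \<zeta>0 + \<sigma>"
  shows "\<not> series_infinite \<zeta>0 (\<lambda>\<zeta>. R (1 / r \<zeta> * (\<Sum>s=\<zeta>1..\<zeta> - 1. q s * P (\<theta> (s - \<sigma>)))))"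
  using nondecreasing_or_decreasing
proof cases
  case 1
  then show ?thesis using assms by (rule nondecreasing_imp_not_series_1)
next
  case (2 Z')
  then show ?thesis using assms by (rule decreasing_positive_solution.decreasing_imp_not_series_1)
qed

lemma not_series_2:
  "\<not> series_infinite \<zeta>0 (\<lambda>s. q s * rat_pow (m + n) n (\<theta> (s + 1)))"
  using nondecreasing_or_decreasing
proof cases
  case 1
  then show ?thesis by (rule nondecreasing_imp_not_series_2)
next
  case (2 Z')
  then show ?thesis by (rule decreasing_positive_solution.decreasing_imp_not_series_2)
qed

end

lemma is_solution_uminus:
  assumes "odd m" and "is_solution m n \<sigma> \<zeta>0 r q x"
  shows "is_solution m n \<sigma> \<zeta>0 r q (\<lambda>s. - x s)"
proof -
  have "fdiff (\<lambda>s. - f s) s = - fdiff f s" for f s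
    by (simp add: fdiff_def)
  then show ?thesis
    using assms by (simp add: is_solution_def rat_pow_uminus add_eq_0_iff)
qed

theorem theorem2p2:
  fixes m n :: nat and \<sigma> \<zeta>0 :: int and r q :: "int \<Rightarrow> real"
  assumes "odd m" and "odd n" and "coprime m n"
    and "\<sigma> \<ge> 0"
    and "\<And>\<zeta>. \<zeta> \<ge> \<zeta>0 \<Longrightarrow> r \<zeta> > 0"
    and "\<And>\<zeta>. \<zeta> \<ge> \<zeta>0 \<Longrightarrow> q \<zeta> \<ge> 0"
    and "infinite {\<zeta>. \<zeta> \<ge> \<zeta>0 \<and> q \<zeta> \<noteq> 0}"
    and "\<And>\<zeta>. \<zeta> \<ge> \<zeta>0 \<Longrightarrow> (\<lambda>s. 1 / rat_pow n m (r s)) summable_on {\<zeta>..}"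
    and "(\<exists>\<zeta>1\<ge>\<zeta>0 + \<sigma>. series_infinite \<zeta>0
            (\<lambda>\<zeta>. rat_pow n m
               (1 / r \<zeta> * (\<Sum>s=\<zeta>1..\<zeta> - 1. q s * rat_pow m n (theta m n r (s - \<sigma>))))))
       \<or> series_infinite \<zeta>0 (\<lambda>s. q s * rat_pow (m + n) n (theta m n r (s + 1)))"
  shows "equation_oscillates m n \<sigma> \<zeta>0 r q"
proof -
  have not_eventually_pos: "\<not> (\<forall>\<^sub>F \<zeta> in at_top. x \<zeta> > 0)"
    if sol: "is_solution m n \<sigma> \<zeta>0 r q x" for x
  proof
    assume "\<forall>\<^sub>F \<zeta> in at_top. x \<zeta> > 0"
    then obtain M where M: "\<And>s. s \<ge> M \<Longrightarrow> x s > 0"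
      by (auto simp: eventually_at_top_linorder)
    interpret positive_solution m n \<sigma> \<zeta>0 "max M \<zeta>0 + \<sigma>" r q x
      using sol assms(4)
      by unfold_locales (auto simp: assms(1,2,5,6,8) M is_solution_def)
    show False using assms(9) not_series_1 not_series_2 by blast
  qed
  show ?thesis
    unfolding equation_oscillates_def oscillates_def
  proof (intro allI impI conjI)
    fix x assume sol: "is_solution m n \<sigma> \<zeta>0 r q x"
    show "\<not> (\<forall>\<^sub>F \<zeta> in at_top. x \<zeta> > 0)" by (rule not_eventually_pos[OF sol])
    show "\<not> (\<forall>\<^sub>F \<zeta> in at_top. x \<zeta> < 0)"
      using not_eventually_pos[OF is_solution_uminus[OF assms(1) sol]] by simp
  qed
qed

end
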